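(* Let $X=\mathbb R$ with the metric $d(x,y)=|x-y|$ and marked point $0$, and let $\tilde r=\{r_n\}_{n\in\mathbb N}$ be a normalizing sequence. Let $\tilde X_{0,\tilde r}$ be a maximal self-stable family and let $\tilde b=\{b_n\}_{n\in\mathbb N}$ be an element of $\tilde X_{0,\tilde r}$ such that $$\tilde d_{\tilde r}(\tilde 0,\tilde b)=\lim_{n\to\infty}\frac{|b_n|}{r_n}\neq0.$$ The following statements are true. (i) For every $\tilde y=\{y_n\}_{n\in\mathbb N}\in\tilde X_{0,\tilde r}$ there is a finite limit $\lim_{n\to\infty}\frac{y_n}{b_n}$ and, conversely, if $\tilde y\in\tilde X$ and this limit exists and is finite, then $\tilde y\in\tilde X_{0,\tilde r}$. (ii) For every two $\tilde x=\{x_n\}_{n\in\mathbb N}$ and $\tilde y=\{y_n\}_{n\in\mathbb N}$ from $\tilde X_{0,\tilde r}$ the equality $\tilde d_{\tilde r}(\tilde x,\tilde y)=0$ holds if and only if $\lim_{n\to\infty}\frac{x_n}{b_n}=\lim_{n\to\infty}\frac{y_n}{b_n}$. (iii) The pretangent space $\Omega_{0,\tilde r}$ which corresponds to $\tilde X_{0,\tilde r}$ is isometric to $\mathbb R$ with the usual metric, and is tangent.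
   Context: Since $\lim|b_n|/r_n\ne0$, one has $b_n\neq0$ for all large $n$, and the quotients by $b_n$ are considered for such $n$. Pretangent and tangent spaces. Let $(X,d)$ be a metric space with a marked point $a\in X$ (here $a=0$). A normalizing sequence is a sequence $\tilde r=\{r_n\}_{n\in\mathbb N}$ of positive reals with $r_n\to0$. $\tilde X$ is the set of all sequences of points of $X$. Sequences $\tilde x=\{x_n\},\tilde y=\{y_n\}\in\tilde X$ are mutually stable w.r.t. $\tilde r$ if the finite limit $\tilde d_{\tilde r}(\tilde x,\tilde y)=\tilde d(\tilde x,\tilde y):=\lim_{n\to\infty} d(x_n,y_n)/r_n$ exists. A family $\tilde F\subseteq\tilde X$ is self-stable (w.r.t. $\tilde r$) if every two of its elements are mutually stable; it is maximal self-stable if it is self-stable and every $\tilde z\in\tilde X$ either belongs to $\tilde F$ or is not mutually stable with some $\tilde x\in\tilde F$. Write $\tilde a=(a,a,\dots)$. $\tilde X_{a,\tilde r}$ denotes a maximal self-stable (w.r.t. $\tilde r$) family containing $\tilde a$; $\tilde d$ is a pseudometric on it. The metric identification of $(\tilde X_{a,\tilde r},\tilde d)$ (the quotient by $\tilde d(\tilde x,\tilde y)=0$ with the induced metric) is denoted $\Omega_{a,\tilde r}$ and called the pretangent space corresponding to $\tilde X_{a,\tilde r}$. An isometry is a distance-preserving surjection. For a subsequence $\tilde r'=\{r_{n_k}\}_k$ of $\tilde r$ ($n_k$ strictly increasing) and $\tilde x\in\tilde X$ put $\tilde x'=\{x_{n_k}\}_k$. There is a maximal self-stable (w.r.t. $\tilde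 r'$) family $\tilde X_{a,\tilde r'}\supseteq\{\tilde x':\tilde x\in\tilde X_{a,\tilde r}\}$, and $\tilde x\mapsto\tilde x'$ induces a distance-preserving map $em':\Omega_{a,\tilde r}\to\Omega_{a,\tilde r'}$, where $\Omega_{a,\tilde r'}$ is the metric identification of $\tilde X_{a,\tilde r'}$. The pretangent space $\Omega_{a,\tilde r}$ is tangent if $em'$ is an isometry for every subsequence $\tilde r'$ (this does not depend on the choice of $\tilde X_{a,\tilde r'}$). *)

theory Defs
  imports "HOL-Analysis.Analysis"
begin

section \<open>Self-stable families of sequences\<close>

definition normalizing_sequence :: "(nat \<Rightarrow> real) \<Rightarrow> bool" where
  "normalizing_sequence r \<longleftrightarrow> (\<forall>n. r n > 0) \<and> r \<longlonglongrightarrow> 0"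

definition mutually_stable ::
    "(nat \<Rightarrow> real) \<Rightarrow> (nat \<Rightarrow> 'a::metric_space) \<Rightarrow> (nat \<Rightarrow> 'a) \<Rightarrow> bool" where
  "mutually_stable r x y \<longleftrightarrow> convergent (\<lambda>n. dist (x n) (y n) / r n)"

text \<open>Meaningful only for mutually stable sequences, as \<^const>\<open>lim\<close> is unspecified otherwise.\<close>

definition scaled_dist ::
    "(nat \<Rightarrow> real) \<Rightarrow> (nat \<Rightarrow> 'a::metric_space) \<Rightarrow> (nat \<Rightarrow> 'a) \<Rightarrow> real" where
  "scaled_dist r x y = lim (\<lambda>n. dist (x n) (y n) / r n)"

definition self_stable :: "(nat \<Rightarrow> real) \<Rightarrow> (nat \<Rightarrow> 'a::metric_space) set \<Rightarrow> bool" where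
  "self_stable r F \<longleftrightarrow> (\<forall>x\<in>F. \<forall>y\<in>F. mutually_stable r x y)"

definition maximal_self_stable :: "(nat \<Rightarrow> real) \<Rightarrow> (nat \<Rightarrow> 'a::metric_space) set \<Rightarrow> bool" where
  "maximal_self_stable r F \<longleftrightarrow>
     self_stable r F \<and> (\<forall>z. z \<in> F \<or> (\<exists>x\<in>F. \<not> mutually_stable r z x))"

definition maximal_self_stable_at ::
    "'a::metric_space \<Rightarrow> (nat \<Rightarrow> real) \<Rightarrow> (nat \<Rightarrow> 'a) set \<Rightarrow> bool" where
  "maximal_self_stable_at a r F \<longleftrightarrow> maximal_self_stable r F \<and> (\<lambda>_. a) \<in> F"


section \<open>Pretangent and tangent spaces\<close>

definition zero_dist_rel ::
    "(nat \<Rightarrow> real) \<Rightarrow> (nat \<Rightarrow> 'a::metric_space) set \<Rightarrow> ((nat \<Rightarrow> 'a) \<times> (nat \<Rightarrow> 'a)) set" where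
  "zero_dist_rel r F = {(x, y). x \<in> F \<and> y \<in> F \<and> scaled_dist r x y = 0}"

definition pretangent_space ::
    "(nat \<Rightarrow> real) \<Rightarrow> (nat \<Rightarrow> 'a::metric_space) set \<Rightarrow> (nat \<Rightarrow> 'a) set set" where
  "pretangent_space r F = F // zero_dist_rel r F"

text \<open>The distance does not depend on the representatives, see \<open>pretangent_dist_class\<close> below.\<close>

definition pretangent_dist ::
    "(nat \<Rightarrow> real) \<Rightarrow> (nat \<Rightarrow> 'a::metric_space) set \<Rightarrow> (nat \<Rightarrow> 'a) set \<Rightarrow> real" where
  "pretangent_dist r A B = (THE t. \<exists>x\<in>A. \<exists>y\<in>B. t = scaled_dist r x y)"

definition isometry ::
    "'p set \<Rightarrow> ('p \<Rightarrow> 'p \<Rightarrow> real) \<Rightarrow> 'q set \<Rightarrow> ('q \<Rightarrow> 'q \<Rightarrow> real) \<Rightarrow> ('p \<Rightarrow> 'q) \<Rightarrow> bool" where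
  "isometry M d N e f \<longleftrightarrow>
     f ` M = N \<and> (\<forall>x\<in>M. \<forall>y\<in>M. e (f x) (f y) = d x y)"

definition isometric ::
    "'p set \<Rightarrow> ('p \<Rightarrow> 'p \<Rightarrow> real) \<Rightarrow> 'q set \<Rightarrow> ('q \<Rightarrow> 'q \<Rightarrow> real) \<Rightarrow> bool" where
  "isometric M d N e \<longleftrightarrow> (\<exists>f. isometry M d N e f)"

text \<open>
  A subsequence is given by a strictly increasing index map \<open>k\<close>. The map below sends the class of
  \<open>x\<close> to the class of \<open>x \<circ> k\<close> in the metric identification of \<open>F'\<close>; the classes in the union all
  coincide, see \<open>pretangent_embed_class\<close> below.
\<close>

definition pretangent_embed ::
    "(nat \<Rightarrow> real) \<Rightarrow> (nat \<Rightarrow> nat) \<Rightarrow> (nat \<Rightarrow> 'a::metric_space) set \<Rightarrow>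
     (nat \<Rightarrow> 'a) set \<Rightarrow> (nat \<Rightarrow> 'a) set" where
  "pretangent_embed r k F' A = (\<Union>x\<in>A. zero_dist_rel (r \<circ> k) F' `` {x \<circ> k})"

text \<open>
  Families \<open>F'\<close> as required always exist, see \<open>subsequence_family_exists\<close> below.
\<close>

definition tangent_space ::
    "'a::metric_space \<Rightarrow> (nat \<Rightarrow> real) \<Rightarrow> (nat \<Rightarrow> 'a) set \<Rightarrow> bool" where
  "tangent_space a r F \<longleftrightarrow>
     (\<forall>k F'. strict_mono k \<and> maximal_self_stable_at a (r \<circ> k) F' \<and> (\<lambda>x. x \<circ> k) ` F \<subseteq> F' \<longrightarrow>
        isometry (pretangent_space r F) (pretangent_dist r)
                 (pretangent_space (r \<circ> k) F') (pretangent_dist (r \<circ> k))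
                 (pretangent_embed r k F'))"


section \<open>Well-definedness\<close>

lemma mutually_stable_tendsto:
  "mutually_stable r x y \<longleftrightarrow> (\<lambda>n. dist (x n) (y n) / r n) \<longlonglongrightarrow> scaled_dist r x y"
  unfolding mutually_stable_def scaled_dist_def by (rule convergent_LIMSEQ_iff)

lemma scaled_dist_self [simp]: "scaled_dist r x x = 0"
  by (simp add: scaled_dist_def)

lemma scaled_dist_commute: "scaled_dist r x y = scaled_dist r y x"
  by (simp add: scaled_dist_def dist_commute)

lemma mutually_stable_commute: "mutually_stable r x y \<longleftrightarrow> mutually_stable r y x"
  by (simp add: mutually_stable_def dist_commute)

lemma mutually_stable_self [simp]: "mutually_stable r x x"
  by (simp add: mutually_stable_def convergent_const)

context
  fixes r :: "nat \<Rightarrow> real" and F :: "(nat \<Rightarrow> 'a::metric_space) set"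
  assumes pos: "\<And>n. r n > 0" and stable: "self_stable r F"
begin

lemma scaled_dist_tendsto:
  assumes "x \<in> F" "y \<in> F"
  shows "(\<lambda>n. dist (x n) (y n) / r n) \<longlonglongrightarrow> scaled_dist r x y"
  using stable assms by (auto simp: self_stable_def mutually_stable_tendsto)

lemma scaled_dist_nonneg:
  assumes "x \<in> F" "y \<in> F"
  shows "0 \<le> scaled_dist r x y"
  by (rule LIMSEQ_le_const[OF scaled_dist_tendsto[OF assms]])
     (use pos in \<open>auto simp: less_imp_le\<close>)

lemma scaled_dist_triangle:
  assumes "x \<in> F" "y \<in> F" "z \<in> F"
  shows "scaled_dist r x z \<le> scaled_dist r x y + scaled_dist r y z"
proof (rule LIMSEQ_le)
  show "(\<lambda>n. dist (x n) (z n) / r n) \<longlonglongrightarrow> scaled_dist r x z"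
    using assms by (intro scaled_dist_tendsto)
  show "(\<lambda>n. dist (x n) (y n) / r n + dist (y n) (z n) / r n)
          \<longlonglongrightarrow> scaled_dist r x y + scaled_dist r y z"
    using assms by (intro tendsto_add scaled_dist_tendsto)
  show "\<exists>N. \<forall>n\<ge>N. dist (x n) (z n) / r n \<le> dist (x n) (y n) / r n + dist (y n) (z n) / r n"
    by (simp flip: add_divide_distrib add: divide_right_mono dist_triangle pos[THEN less_imp_le])
qed

lemma equiv_zero_dist_rel: "equiv F (zero_dist_rel r F)"
proof (rule equivI)
  show "trans (zero_dist_rel r F)"
  proof (rule transI)
    fix x y z assume "(x, y) \<in> zero_dist_rel r F" "(y, z) \<in> zero_dist_rel r F"
    then show "(x, z) \<in> zero_dist_rel r F"
      using scaled_dist_triangle[of x y z] scaled_dist_nonneg[of x z]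
      by (auto simp: zero_dist_rel_def)
  qed
qed (auto simp: zero_dist_rel_def refl_on_def sym_def scaled_dist_commute)

lemma scaled_dist_cong:
  assumes "(x, x') \<in> zero_dist_rel r F" "(y, y') \<in> zero_dist_rel r F"
  shows "scaled_dist r x' y' = scaled_dist r x y"
proof -
  have F: "x \<in> F" "x' \<in> F" "y \<in> F" "y' \<in> F" 
    and z: "scaled_dist r x x' = 0" "scaled_dist r y y' = 0"
    using assms by (auto simp: zero_dist_rel_def)
  show ?thesis
    using z scaled_dist_triangle[of x' x y'] scaled_dist_triangle[of x y y']
      scaled_dist_triangle[of x x' y] scaled_dist_triangle[of x' y' y] F
    by (simp add: scaled_dist_commute[of r x' x] scaled_dist_commute[of r y' y])
qed

lemma pretangent_dist_class:
  assumes "x \<in> F" "y \<in> F"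
  shows "pretangent_dist r (zero_dist_rel r F `` {x}) (zero_dist_rel r F `` {y}) = scaled_dist r x y"
  unfolding pretangent_dist_def
proof (rule the_equality)
  show "\<exists>x'\<in>zero_dist_rel r F `` {x}. \<exists>y'\<in>zero_dist_rel r F `` {y}.
          scaled_dist r x y = scaled_dist r x' y'"
    using assms by (intro bexI[of _ x] bexI[of _ y]) (auto simp: zero_dist_rel_def)
qed (auto simp: scaled_dist_cong)

lemma Metric_space_pretangent: "Metric_space (pretangent_space r F) (\<lambda>A B.
    if A \<in> pretangent_space r F \<and> B \<in> pretangent_space r F then pretangent_dist r A B else 0)"
  (is "Metric_space _ ?d")
proof -
  have *: "zero_dist_rel r F `` {x} = zero_dist_rel r F `` {y} \<longleftrightarrow> scaled_dist r x y = 0"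
    if "x \<in> F" "y \<in> F" for x y
    using eq_equiv_class_iff[OF equiv_zero_dist_rel that] that by (simp add: zero_dist_rel_def)
  show ?thesis
  proof
    fix A B C
    show "0 \<le> ?d A B" "?d A B = ?d B A"
      by (auto simp: pretangent_space_def quotient_def pretangent_dist_class scaled_dist_nonneg
          scaled_dist_commute)
    assume AB: "A \<in> pretangent_space r F" "B \<in> pretangent_space r F"
    then obtain x y where xy: "x \<in> F" "A = zero_dist_rel r F `` {x}" "y \<in> F" "B = zero_dist_rel r F `` {y}"
      by (auto simp: pretangent_space_def elim!: quotientE)
    show "?d A B = 0 \<longleftrightarrow> A = B"
      using AB xy * by (simp add: pretangent_dist_class)
    assume C: "C \<in> pretangent_space r F"
    then obtain z where z: "z \<in> F" "C = zero_dist_rel r F `` {z}"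
      by (auto simp: pretangent_space_def elim!: quotientE)
    show "?d A C \<le> ?d A B + ?d B C"
      using AB C xy z by (simp add: pretangent_dist_class scaled_dist_triangle)
  qed
qed

end

lemma
  fixes F F' :: "(nat \<Rightarrow> 'a::metric_space) set"
  assumes pos: "\<And>n. r n > 0" and stable: "self_stable r F"
    and k: "strict_mono k" and stable': "self_stable (r \<circ> k) F'"
    and sub: "(\<lambda>x. x \<circ> k) ` F \<subseteq> F'"
  shows scaled_dist_subseq:
      "\<And>x y. x \<in> F \<Longrightarrow> y \<in> F \<Longrightarrow> scaled_dist (r \<circ> k) (x \<circ> k) (y \<circ> k) = scaled_dist r x y"
    and pretangent_embed_class:
      "\<And>x. x \<in> F \<Longrightarrow> pretangent_embed r k F' (zero_dist_rel r F `` {x}) =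
                      zero_dist_rel (r \<circ> k) F' `` {x \<circ> k}"
proof -
  show eq: "scaled_dist (r \<circ> k) (x \<circ> k) (y \<circ> k) = scaled_dist r x y" if "x \<in> F" "y \<in> F" for x y
  proof -
    have "((\<lambda>n. dist (x n) (y n) / r n) \<circ> k) \<longlonglongrightarrow> scaled_dist r x y"
      by (rule LIMSEQ_subseq_LIMSEQ[OF _ k])
         (use scaled_dist_tendsto[OF pos stable that] in simp)
    then show ?thesis
      unfolding scaled_dist_def[of "r \<circ> k"] by (intro limI) (simp add: o_def)
  qed
  fix x assume x: "x \<in> F"
  have pos': "(r \<circ> k) n > 0" for n using pos by simp
  have "zero_dist_rel (r \<circ> k) F' `` {z \<circ> k} = zero_dist_rel (r \<circ> k) F' `` {x \<circ> k}"
    if "z \<in> zero_dist_rel r F `` {x}" for z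
  proof (rule equiv_class_eq[OF equiv_zero_dist_rel[OF pos' stable']])
    show "(z \<circ> k, x \<circ> k) \<in> zero_dist_rel (r \<circ> k) F'"
      using that x sub eq[of z x] by (auto simp: zero_dist_rel_def scaled_dist_commute)
  qed
  moreover have "x \<in> zero_dist_rel r F `` {x}" using x by (simp add: zero_dist_rel_def)
  ultimately show "pretangent_embed r k F' (zero_dist_rel r F `` {x}) =
                   zero_dist_rel (r \<circ> k) F' `` {x \<circ> k}"
    unfolding pretangent_embed_def by blast
qed

lemma maximal_self_stable_extend:
  fixes G :: "(nat \<Rightarrow> 'a::metric_space) set"
  assumes "self_stable r G"
  shows "\<exists>F. maximal_self_stable r F \<and> G \<subseteq> F"
proof -
  let ?S = "{F. self_stable r F \<and> G \<subseteq> F}"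
  have "\<exists>M\<in>?S. \<forall>X\<in>?S. M \<subseteq> X \<longrightarrow> X = M"
  proof (rule subset_Zorn_nonempty)
    show "?S \<noteq> {}" using assms by auto
    fix C assume C: "C \<noteq> {}" "subset.chain ?S C"
    have "mutually_stable r x y" if "x \<in> \<Union>C" and "y \<in> \<Union>C" for x y
    proof -
      from that obtain A B where AB: "A \<in> C" "B \<in> C" "x \<in> A" "y \<in> B" by blast
      then have "A \<subseteq> B \<or> B \<subseteq> A" using C(2) by (auto simp: subset_chain_def)
      then have "\<exists>D\<in>C. x \<in> D \<and> y \<in> D" using AB by blast
      then show ?thesis using C(2) by (auto simp: subset_chain_def self_stable_def)
    qed
    then have "self_stable r (\<Union>C)" unfolding self_stable_def by blast
    moreover have "G \<subseteq> \<Union>C" using C unfolding subset_chain_def by blast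
    ultimately show "\<Union>C \<in> ?S" by blast
  qed
  then obtain M where M: "self_stable r M" "G \<subseteq> M"
    and max: "\<And>X. self_stable r X \<Longrightarrow> M \<subseteq> X \<Longrightarrow> X = M" by force
  have "z \<in> M" if "\<forall>x\<in>M. mutually_stable r z x" for z
  proof -
    have "self_stable r (insert z M)"
      using M(1) that by (auto simp: self_stable_def mutually_stable_commute)
    then show ?thesis using max[of "insert z M"] by auto
  qed
  then show ?thesis using M by (auto simp: maximal_self_stable_def)
qed

lemma subsequence_family_exists:
  fixes F :: "(nat \<Rightarrow> 'a::metric_space) set"
  assumes F: "maximal_self_stable_at a r F" and k: "strict_mono k"
  shows "\<exists>F'. maximal_self_stable_at a (r \<circ> k) F' \<and> (\<lambda>x. x \<circ> k) ` F \<subseteq> F'"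
proof -
  have "self_stable (r \<circ> k) ((\<lambda>x. x \<circ> k) ` F)"
  proof -
    have "mutually_stable (r \<circ> k) (x \<circ> k) (y \<circ> k)" if "x \<in> F" "y \<in> F" for x y
    proof -
      have "convergent ((\<lambda>n. dist (x n) (y n) / r n) \<circ> k)"
        by (rule convergent_subseq_convergent[OF _ k])
           (use F that in \<open>auto simp: maximal_self_stable_at_def maximal_self_stable_def
              self_stable_def mutually_stable_def\<close>)
      then show ?thesis by (simp add: mutually_stable_def o_def)
    qed
    then show ?thesis by (auto simp: self_stable_def)
  qed
  from maximal_self_stable_extend[OF this] obtain F'
    where F': "maximal_self_stable (r \<circ> k) F'" "(\<lambda>x. x \<circ> k) ` F \<subseteq> F'" by blast
  moreover have "(\<lambda>_. a) \<in> (\<lambda>x. x \<circ> k) ` F"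
    using F by (intro image_eqI[of _ _ "\<lambda>_. a"]) (auto simp: maximal_self_stable_at_def o_def)
  ultimately show ?thesis by (auto simp: maximal_self_stable_at_def)
qed

end

theory Submission
  imports Defs
begin

text \<open>
  A sequence \<open>b\<close> in the family with \<open>\<bar>b n\<bar> / r n \<longlonglongrightarrow> \<beta> > 0\<close> serves as a unit of measurement: the
  limit of \<open>x n / b n\<close> is a signed coordinate of \<open>x\<close>. Two facts make this work. If \<open>x\<close> and \<open>y\<close>
  have coordinates \<open>s\<close> and \<open>t\<close>, factoring out \<open>\<bar>b n\<bar>\<close> shows that they are at scaled distance
  \<open>\<bar>s - t\<bar> * \<beta>\<close> (\<open>scaled_dist_coordinates\<close>). Conversely, the squared distances
  between \<open>0\<close>, \<open>b\<close> and \<open>y\<close> determine the limit of \<open>y n * b n / (r n)\<^sup>2\<close>, by polarization, and hence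
  the coordinate of \<open>y\<close> (\<open>coordinate_exists\<close>). So the sequences having a coordinate are
  pairwise mutually stable, and a maximal family consists of exactly these sequences
  (\<open>mem_iff_convergent_quotient\<close>).

  The coordinate, multiplied by \<open>\<beta>\<close>, is then an isometry of the pretangent space onto the line,
  every real \<open>t\<close> being the coordinate of \<open>t * b\<close>. Passing to a subsequence turns \<open>b\<close> into a unit
  \<open>b \<circ> k\<close> of the new family with the same \<open>\<beta>\<close>, and a sequence of that family with coordinate \<open>t\<close> is
  at distance \<open>0\<close> from the subsequence of \<open>t * b\<close>. Therefore passing to a
  subsequence creates no new points, which is tangency.
\<close>

section \<open>Coordinates with respect to a sequence at positive distance from zero\<close>

text \<open>
  Stated as a locale since tangency requires all of this both for the family itself and for
  the families belonging to its subsequences.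
\<close>

locale unit_in_maximal_family =
  fixes r :: "nat \<Rightarrow> real" and F :: "(nat \<Rightarrow> real) set" and b :: "nat \<Rightarrow> real"
  assumes pos: "\<And>n. r n > 0"
    and maximal: "maximal_self_stable_at 0 r F"
    and unit_mem: "b \<in> F"
    and unit_nonzero: "scaled_dist r (\<lambda>_. 0) b \<noteq> 0"
begin

definition unit_length :: real where
  "unit_length = scaled_dist r (\<lambda>_. 0) b"

definition coordinate :: "(nat \<Rightarrow> real) \<Rightarrow> real" where
  "coordinate x = lim (\<lambda>n. x n / b n)"

lemma stable: "self_stable r F"
  using maximal by (simp add: maximal_self_stable_at_def maximal_self_stable_def)

lemma zero_mem: "(\<lambda>_. 0) \<in> F"
  using maximal by (simp add: maximal_self_stable_at_def)

lemma abs_tendsto: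
  assumes "x \<in> F"
  shows "(\<lambda>n. \<bar>x n\<bar> / r n) \<longlonglongrightarrow> scaled_dist r (\<lambda>_. 0) x"
  using scaled_dist_tendsto[OF pos stable zero_mem assms] by (simp add: dist_real_def)

lemma unit_tendsto: "(\<lambda>n. \<bar>b n\<bar> / r n) \<longlonglongrightarrow> unit_length"
  using abs_tendsto[OF unit_mem] by (simp add: unit_length_def)

lemma unit_length_pos: "unit_length > 0"
  using scaled_dist_nonneg[OF pos stable zero_mem unit_mem] unit_nonzero
  by (simp add: unit_length_def)

lemma eventually_unit_nonzero: "eventually (\<lambda>n. b n \<noteq> 0) sequentially"
  using order_tendstoD(1)[OF unit_tendsto unit_length_pos] by eventually_elim auto

text \<open>
  Polarization, \<open>2 * y * b = y\<^sup>2 + b\<^sup>2 - (y - b)\<^sup>2\<close>, recovers the sign that the distance of \<open>y\<close>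
  to \<open>0\<close> alone does not see.
\<close>

lemma coordinate_exists:
  assumes "y \<in> F"
  shows "convergent (\<lambda>n. y n / b n)"
proof -
  have "(\<lambda>n. ((\<bar>y n\<bar> / r n)\<^sup>2 + (\<bar>b n\<bar> / r n)\<^sup>2 - (dist (y n) (b n) / r n)\<^sup>2) / (2 * (\<bar>b n\<bar> / r n)\<^sup>2))
      \<longlonglongrightarrow> ((scaled_dist r (\<lambda>_. 0) y)\<^sup>2 + unit_length\<^sup>2 - (scaled_dist r y b)\<^sup>2) / (2 * unit_length\<^sup>2)"
    using unit_length_pos
    by (intro tendsto_intros abs_tendsto[OF assms] unit_tendsto
        scaled_dist_tendsto[OF pos stable assms unit_mem]) auto
  moreover have "eventually (\<lambda>n. ((\<bar>y n\<bar> / r n)\<^sup>2 + (\<bar>b n\<bar> / r n)\<^sup>2 - (dist (y n) (b n) / r n)\<^sup>2)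
      / (2 * (\<bar>b n\<bar> / r n)\<^sup>2) = y n / b n) sequentially"
    using eventually_unit_nonzero
  proof eventually_elim
    case (elim n)
    have "(\<bar>y n\<bar> / r n)\<^sup>2 + (\<bar>b n\<bar> / r n)\<^sup>2 - (dist (y n) (b n) / r n)\<^sup>2 = 2 * (y n * b n) / (r n)\<^sup>2"
      by (simp add: dist_real_def power_divide power2_diff flip: add_divide_distrib diff_divide_distrib)
    then show ?case
      using elim pos[of n] by (simp add: power_divide power2_eq_square)
  qed
  ultimately show ?thesis
    by (intro convergentI) (rule Lim_transform_eventually)
qed

lemma coordinate_tendsto:
  assumes "y \<in> F"
  shows "(\<lambda>n. y n / b n) \<longlonglongrightarrow> coordinate y"
  using coordinate_exists[OF assms] by (simp add: coordinate_def convergent_LIMSEQ_iff)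

text \<open>
  The sequences range over all sequences here, not over the family: it is this form that
  decides membership in the family.
\<close>

lemma scaled_dist_coordinates:
  assumes "(\<lambda>n. x n / b n) \<longlonglongrightarrow> s" "(\<lambda>n. y n / b n) \<longlonglongrightarrow> t"
  shows "(\<lambda>n. dist (x n) (y n) / r n) \<longlonglongrightarrow> \<bar>s - t\<bar> * unit_length"
proof (rule Lim_transform_eventually)
  show "(\<lambda>n. \<bar>x n / b n - y n / b n\<bar> * (\<bar>b n\<bar> / r n)) \<longlonglongrightarrow> \<bar>s - t\<bar> * unit_length"
    by (intro tendsto_intros assms unit_tendsto)
  show "eventually (\<lambda>n. \<bar>x n / b n - y n / b n\<bar> * (\<bar>b n\<bar> / r n) = dist (x n) (y n) / r n) sequentially"
    using eventually_unit_nonzero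
    by eventually_elim (simp add: dist_real_def flip: diff_divide_distrib)
qed

lemma mem_iff_convergent_quotient: "y \<in> F \<longleftrightarrow> convergent (\<lambda>n. y n / b n)"
proof
  assume "convergent (\<lambda>n. y n / b n)"
  then obtain t where t: "(\<lambda>n. y n / b n) \<longlonglongrightarrow> t"
    by (auto simp: convergent_def)
  have "mutually_stable r y x" if "x \<in> F" for x
    unfolding mutually_stable_def
    by (rule convergentI) (rule scaled_dist_coordinates[OF t coordinate_tendsto[OF that]])
  then show "y \<in> F"
    using maximal by (auto simp: maximal_self_stable_at_def maximal_self_stable_def)
qed (rule coordinate_exists)

lemma scaled_dist_eq:
  assumes "x \<in> F" "y \<in> F"
  shows "scaled_dist r x y = \<bar>coordinate x - coordinate y\<bar> * unit_length"
  unfolding scaled_dist_def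
  by (rule limI) (rule scaled_dist_coordinates[OF assms[THEN coordinate_tendsto]])

lemma scaled_dist_zero_iff:
  assumes "x \<in> F" "y \<in> F"
  shows "scaled_dist r x y = 0 \<longleftrightarrow> coordinate x = coordinate y"
  using scaled_dist_eq[OF assms] unit_length_pos by auto

lemma multiple_tendsto: "(\<lambda>n. t * b n / b n) \<longlonglongrightarrow> t"
  by (rule tendsto_eventually) (use eventually_unit_nonzero in eventually_elim, simp)

lemma multiple_mem: "(\<lambda>n. t * b n) \<in> F"
  using convergentI[OF multiple_tendsto] by (simp add: mem_iff_convergent_quotient)

lemma coordinate_multiple: "coordinate (\<lambda>n. t * b n) = t"
  unfolding coordinate_def by (rule limI[OF multiple_tendsto])


section \<open>The pretangent space is a line\<close>

lemma mem_pretangent_space_iff: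
  "A \<in> pretangent_space r F \<longleftrightarrow> (\<exists>x\<in>F. A = zero_dist_rel r F `` {x})"
  by (auto simp: pretangent_space_def quotient_def)

text \<open>
  Coordinates measure lengths in multiples of \<open>b\<close>, so they have to be rescaled by the length of
  \<open>b\<close> to preserve distances.
\<close>

lemma isometric_pretangent_real:
  "isometric (pretangent_space r F) (pretangent_dist r) (UNIV :: real set) dist"
proof -
  define f where "f A = unit_length * coordinate (SOME x. x \<in> A)" for A
  have f: "f (zero_dist_rel r F `` {x}) = unit_length * coordinate x" if "x \<in> F" for x
  proof -
    have "x \<in> zero_dist_rel r F `` {x}"
      using that by (simp add: zero_dist_rel_def)
    then have "(SOME y. y \<in> zero_dist_rel r F `` {x}) \<in> zero_dist_rel r F `` {x}"
      by (rule someI[of "\<lambda>y. y \<in> zero_dist_rel r F `` {x}"])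
    then show ?thesis
      using scaled_dist_zero_iff unfolding f_def by (auto simp: zero_dist_rel_def)
  qed
  have "isometry (pretangent_space r F) (pretangent_dist r) UNIV dist f"
    unfolding isometry_def
  proof (intro conjI ballI)
    have "t \<in> f ` pretangent_space r F" for t
    proof (rule image_eqI)
      show "t = f (zero_dist_rel r F `` {\<lambda>n. t / unit_length * b n})"
        using f[OF multiple_mem, of "t / unit_length"] unit_length_pos
        by (simp only: coordinate_multiple) simp
      show "zero_dist_rel r F `` {\<lambda>n. t / unit_length * b n} \<in> pretangent_space r F"
        unfolding mem_pretangent_space_iff using multiple_mem by blast
    qed
    then show "f ` pretangent_space r F = UNIV" by blast
    fix A B assume "A \<in> pretangent_space r F" "B \<in> pretangent_space r F"
    then obtain x y where xy: "x \<in> F" "A = zero_dist_rel r F `` {x}"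
        "y \<in> F" "B = zero_dist_rel r F `` {y}"
      by (auto simp: mem_pretangent_space_iff)
    have "dist (unit_length * coordinate x) (unit_length * coordinate y)
        = \<bar>coordinate x - coordinate y\<bar> * unit_length"
      using unit_length_pos by (simp add: dist_real_def abs_mult flip: right_diff_distrib)
    then show "dist (f A) (f B) = pretangent_dist r A B"
      using xy by (simp add: f pretangent_dist_class[OF pos stable] scaled_dist_eq)
  qed
  then show ?thesis unfolding isometric_def by blast
qed


section \<open>Passing to subsequences\<close>

lemma unit_in_subsequence_family:
  assumes k: "strict_mono k" and F': "maximal_self_stable_at 0 (r \<circ> k) F'"
    and sub: "(\<lambda>x. x \<circ> k) ` F \<subseteq> F'"
  shows "unit_in_maximal_family (r \<circ> k) F' (b \<circ> k)"
proof
  have stable': "self_stable (r \<circ> k) F'"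
    using F' by (simp add: maximal_self_stable_at_def maximal_self_stable_def)
  have "scaled_dist (r \<circ> k) ((\<lambda>_. 0) \<circ> k) (b \<circ> k) = scaled_dist r (\<lambda>_. 0) b"
    by (rule scaled_dist_subseq[OF pos stable k stable' sub zero_mem unit_mem])
  then show "scaled_dist (r \<circ> k) (\<lambda>_. 0) (b \<circ> k) \<noteq> 0"
    using unit_nonzero by (simp add: o_def)
qed (use pos F' sub unit_mem in auto)

lemma tangent: "tangent_space 0 r F"
  unfolding tangent_space_def
proof (intro allI impI, elim conjE)
  fix k F'
  assume k: "strict_mono k" and F': "maximal_self_stable_at 0 (r \<circ> k) F'"
    and sub: "(\<lambda>x. x \<circ> k) ` F \<subseteq> F'"
  interpret sub: unit_in_maximal_family "r \<circ> k" F' "b \<circ> k"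
    by (rule unit_in_subsequence_family[OF k F' sub])
  note embed = pretangent_embed_class[OF pos stable k sub.stable sub]
  have mem: "x \<circ> k \<in> F'" if "x \<in> F" for x
    using sub that by blast
  show "isometry (pretangent_space r F) (pretangent_dist r)
      (pretangent_space (r \<circ> k) F') (pretangent_dist (r \<circ> k)) (pretangent_embed r k F')"
    unfolding isometry_def
  proof (intro conjI ballI)
    show "pretangent_embed r k F' ` pretangent_space r F = pretangent_space (r \<circ> k) F'"
    proof
      show "pretangent_embed r k F' ` pretangent_space r F \<subseteq> pretangent_space (r \<circ> k) F'"
      proof (rule image_subsetI)
        fix A assume "A \<in> pretangent_space r F"
        then show "pretangent_embed r k F' A \<in> pretangent_space (r \<circ> k) F'"
          unfolding mem_pretangent_space_iff sub.mem_pretangent_space_iff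
          using embed mem by blast
      qed
      show "pretangent_space (r \<circ> k) F' \<subseteq> pretangent_embed r k F' ` pretangent_space r F"
      proof
        fix A assume "A \<in> pretangent_space (r \<circ> k) F'"
        then obtain z where z: "z \<in> F'" "A = zero_dist_rel (r \<circ> k) F' `` {z}"
          by (auto simp: sub.mem_pretangent_space_iff)
        \<comment> \<open>The multiple of \<open>b\<close> with the coordinate of \<open>z\<close> represents a preimage.\<close>
        define x where "x = (\<lambda>n. sub.coordinate z * b n)"
        have x: "x \<in> F"
          unfolding x_def by (rule multiple_mem)
        have "sub.coordinate (x \<circ> k) = sub.coordinate z"
          using sub.coordinate_multiple[of "sub.coordinate z"] by (simp add: x_def o_def)
        then have "(x \<circ> k, z) \<in> zero_dist_rel (r \<circ> k) F'"
          using x z mem by (simp add: zero_dist_rel_def sub.scaled_dist_zero_iff)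
        then have "pretangent_embed r k F' (zero_dist_rel r F `` {x}) = A"
          using equiv_class_eq[OF equiv_zero_dist_rel[OF sub.pos sub.stable]] x z
          by (simp add: embed)
        then show "A \<in> pretangent_embed r k F' ` pretangent_space r F"
          using x mem_pretangent_space_iff by blast
      qed
    qed
    fix A B assume "A \<in> pretangent_space r F" "B \<in> pretangent_space r F"
    then obtain x y where xy: "x \<in> F" "A = zero_dist_rel r F `` {x}"
        "y \<in> F" "B = zero_dist_rel r F `` {y}"
      by (auto simp: mem_pretangent_space_iff)
    then show "pretangent_dist (r \<circ> k) (pretangent_embed r k F' A) (pretangent_embed r k F' B)
        = pretangent_dist r A B"
      by (simp add: embed mem pretangent_dist_class[OF pos stable]
          pretangent_dist_class[OF sub.pos sub.stable]
          scaled_dist_subseq[OF pos stable k sub.stable sub])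
  qed
qed

end

theorem proposition3p2:
  fixes r :: "nat \<Rightarrow> real" and F :: "(nat \<Rightarrow> real) set" and b :: "nat \<Rightarrow> real"
  assumes "normalizing_sequence r"
    and "maximal_self_stable_at 0 r F"
    and "b \<in> F"
    and "scaled_dist r (\<lambda>_. 0) b \<noteq> 0"
  shows "(\<forall>y\<in>F. convergent (\<lambda>n. y n / b n))
       \<and> (\<forall>y. convergent (\<lambda>n. y n / b n) \<longrightarrow> y \<in> F)
       \<and> (\<forall>x\<in>F. \<forall>y\<in>F. scaled_dist r x y = 0 \<longleftrightarrow> lim (\<lambda>n. x n / b n) = lim (\<lambda>n. y n / b n))
       \<and> isometric (pretangent_space r F) (pretangent_dist r) (UNIV :: real set) dist
       \<and> tangent_space 0 r F"
proof -
  interpret unit_in_maximal_family r F b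
    using assms by unfold_locales (auto simp: normalizing_sequence_def)
  show ?thesis
    using mem_iff_convergent_quotient scaled_dist_zero_iff isometric_pretangent_real tangent
    by (simp add: coordinate_def)
qed

end
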